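(* Let $\mathcal{B}$ be a bornology on a cardinal $\kappa$ such that $\{\kappa\setminus B: B\in\mathcal{B}\}$ is an ultrafilter on $\kappa$. Then the hyperballean $[\kappa]^{\mathcal{B}}$ is not normal.
   Context: **Bornologies.** A bornology on a set $X$ is a family $\mathcal{B}$ of subsets of $X$ that contains all finite subsets of $X$ and is closed under finite unions and taking subsets. **Balleans.** A coarse structure on a set $X$ is a family $\mathcal{E}$ of subsets of $X\times X$ such that: each $E\in\mathcal{E}$ contains the diagonal $\triangle_X$; if $E,E'\in\mathcal{E}$ then $E\circ E'\in\mathcal{E}$ and $E^{-1}\in\mathcal{E}$, where $E\circ E'=\{(x,y):\exists z\ ((x,z)\in E,\ (z,y)\in E')\}$ and $E^{-1}=\{(y,x):(x,y)\in E\}$; and if $E\in\mathcal{E}$ and $\triangle_X\subseteq E'\subseteq E$ then $E'\in\mathcal{E}$. A subfamily $\mathcal{E}'\subseteq\mathcal{E}$ is a base of $\mathcal{E}$ if each $E\in\mathcal{E}$ is contained in some $E'\in\mathcal{E}'$. The pair $(X,\mathcal{E})$ is called a ballean (coarse space). For $x\in X$, $Y\subseteq X$, $E\in\mathcal{E}$, put $E[x]=\{y\in X:(x,y)\in E\}$ and $E[Y]=\bigcup_{y\in Y}E[y]$. All balleans are connected: for any $x,y\in X$ there is $E\in\mathcal{E}$ with $y\in E[x]$. A subset $Y\subseteq X$ is bounded if $Y\subseteq E[x]$ for some $E\in\mathcal{E}$, $x\in X$. **Normality.** A subset $U\subseteq X$ is an asymptotic neighbourhood of $Y\subseteq X$ if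 for every $E\in\mathcal{E}$ the set $E[Y]\setminus U$ is bounded. Subsets $Y,Z\subseteq X$ are asymptotically disjoint if $E[Y]\cap E[Z]$ is bounded for every $E\in\mathcal{E}$; they are asymptotically separated if they have disjoint asymptotic neighbourhoods. The ballean $(X,\mathcal{E})$ is normal if any two asymptotically disjoint subsets of $X$ are asymptotically separated. **Hyperballeans.** The hyperballean $(X,\mathcal{E})^\flat$ of a ballean $(X,\mathcal{E})$ is the set of all nonempty bounded subsets of $X$ with the coarse structure having the base $\{E^\flat:E\in\mathcal{E}\}$, where $E^\flat[Y]=\{Z: Y\subseteq E[Z],\ Z\subseteq E[Y]\}$. **The ballean $[\kappa]^{\mathcal{B}}$.** A bornology $\mathcal{B}$ on a cardinal $\kappa$ defines the discrete ballean $(\kappa,\mathcal{E}_{\mathcal{B}})$, where $\mathcal{E}_{\mathcal{B}}$ has the base $\{E_B:B\in\mathcal{B}\}$ with $E_B[x]=B$ if $x\in B$ and $E_B[x]=\{x\}$ if $x\in\kappa\setminus B$. Then $[\kappa]^{\mathcal{B}}$ denotes the hyperballean $(\kappa,\mathcal{E}_{\mathcal{B}})^\flat$; its underlying set consists of the nonempty members of $\mathcal{B}$. *)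

theory Defs
  imports Main
begin

definition bornology :: "'a set \<Rightarrow> 'a set set \<Rightarrow> bool" where
  "bornology X \<B> \<longleftrightarrow>
     \<B> \<subseteq> Pow X \<and>
     (\<forall>F. F \<subseteq> X \<and> finite F \<longrightarrow> F \<in> \<B>) \<and>
     (\<forall>A\<in>\<B>. \<forall>B\<in>\<B>. A \<union> B \<in> \<B>) \<and>
     (\<forall>B\<in>\<B>. \<forall>A. A \<subseteq> B \<longrightarrow> A \<in> \<B>)"

definition filter_on :: "'a set \<Rightarrow> 'a set set \<Rightarrow> bool" where
  "filter_on X \<F> \<longleftrightarrow>
     \<F> \<subseteq> Pow X \<and> X \<in> \<F> \<and> {} \<notin> \<F> \<and>
     (\<forall>A\<in>\<F>. \<forall>B\<in>\<F>. A \<inter> B \<in> \<F>) \<and>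
     (\<forall>A\<in>\<F>. \<forall>B. A \<subseteq> B \<and> B \<subseteq> X \<longrightarrow> B \<in> \<F>)"

definition ultrafilter_on :: "'a set \<Rightarrow> 'a set set \<Rightarrow> bool" where
  "ultrafilter_on X \<F> \<longleftrightarrow>
     filter_on X \<F> \<and> (\<forall>\<G>. filter_on X \<G> \<and> \<F> \<subseteq> \<G> \<longrightarrow> \<G> = \<F>)"

text \<open>A ballean is a pair of its underlying set and its coarse structure. The ball \<open>E[x]\<close> is
  \<open>E `` {x}\<close>, the set \<open>E[Y]\<close> is \<open>E `` Y\<close>, and the composition of entourages is \<open>(O)\<close>.\<close>

type_synonym 'a ballean = "'a set \<times> 'a rel set"

definition coarse_structure :: "'a set \<Rightarrow> 'a rel set \<Rightarrow> bool" where
  "coarse_structure X \<E> \<longleftrightarrow>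
     (\<forall>E\<in>\<E>. Id_on X \<subseteq> E \<and> E \<subseteq> X \<times> X) \<and>
     (\<forall>E\<in>\<E>. \<forall>E'\<in>\<E>. E O E' \<in> \<E>) \<and>
     (\<forall>E\<in>\<E>. E\<inverse> \<in> \<E>) \<and>
     (\<forall>E\<in>\<E>. \<forall>E'. Id_on X \<subseteq> E' \<and> E' \<subseteq> E \<longrightarrow> E' \<in> \<E>)"

fun is_ballean :: "'a ballean \<Rightarrow> bool" where
  "is_ballean (X, \<E>) \<longleftrightarrow>
     coarse_structure X \<E> \<and> (\<forall>x\<in>X. \<forall>y\<in>X. \<exists>E\<in>\<E>. y \<in> E `` {x})"

text \<open>The only family on \<open>X\<close> that can be a coarse structure with base \<open>\<A>\<close>.\<close>

definition coarse_of_base :: "'a set \<Rightarrow> 'a rel set \<Rightarrow> 'a rel set" where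
  "coarse_of_base X \<A> = {E. Id_on X \<subseteq> E \<and> (\<exists>A\<in>\<A>. E \<subseteq> A)}"

fun bounded_in :: "'a ballean \<Rightarrow> 'a set \<Rightarrow> bool" where
  "bounded_in (X, \<E>) Y \<longleftrightarrow> Y \<subseteq> X \<and> (\<exists>E\<in>\<E>. \<exists>x\<in>X. Y \<subseteq> E `` {x})"

fun asymptotic_nbhd :: "'a ballean \<Rightarrow> 'a set \<Rightarrow> 'a set \<Rightarrow> bool" where
  "asymptotic_nbhd (X, \<E>) Y U \<longleftrightarrow>
     U \<subseteq> X \<and> (\<forall>E\<in>\<E>. bounded_in (X, \<E>) (E `` Y - U))"

fun asymptotically_disjoint :: "'a ballean \<Rightarrow> 'a set \<Rightarrow> 'a set \<Rightarrow> bool" where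
  "asymptotically_disjoint (X, \<E>) Y Z \<longleftrightarrow>
     (\<forall>E\<in>\<E>. bounded_in (X, \<E>) (E `` Y \<inter> E `` Z))"

definition asymptotically_separated :: "'a ballean \<Rightarrow> 'a set \<Rightarrow> 'a set \<Rightarrow> bool" where
  "asymptotically_separated P Y Z \<longleftrightarrow>
     (\<exists>U V. asymptotic_nbhd P Y U \<and> asymptotic_nbhd P Z V \<and> U \<inter> V = {})"

definition normal_ballean :: "'a ballean \<Rightarrow> bool" where
  "normal_ballean P \<longleftrightarrow>
     (\<forall>Y Z. Y \<subseteq> fst P \<and> Z \<subseteq> fst P \<and> asymptotically_disjoint P Y Z
        \<longrightarrow> asymptotically_separated P Y Z)"

definition hyper_points :: "'a ballean \<Rightarrow> 'a set set" where
  "hyper_points P = {Y. Y \<noteq> {} \<and> bounded_in P Y}"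

definition hyper_entourage :: "'a ballean \<Rightarrow> 'a rel \<Rightarrow> 'a set rel" where
  "hyper_entourage P E =
     {(Y, Z). Y \<in> hyper_points P \<and> Z \<in> hyper_points P \<and> Y \<subseteq> E `` Z \<and> Z \<subseteq> E `` Y}"

definition hyperballean :: "'a ballean \<Rightarrow> 'a set ballean" where
  "hyperballean P =
     (hyper_points P, coarse_of_base (hyper_points P) (hyper_entourage P ` snd P))"

definition discrete_entourage :: "'a set \<Rightarrow> 'a set \<Rightarrow> 'a rel" where
  "discrete_entourage X B = {(x, y). x \<in> X \<and> y \<in> (if x \<in> B then B else {x})}"

definition discrete_ballean :: "'a set \<Rightarrow> 'a set set \<Rightarrow> 'a ballean" where
  "discrete_ballean X \<B> = (X, coarse_of_base X (discrete_entourage X ` \<B>))"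

definition bornology_hyperballean :: "'a set \<Rightarrow> 'a set set \<Rightarrow> 'a set ballean" where
  "bornology_hyperballean X \<B> = hyperballean (discrete_ballean X \<B>)"

lemma coarse_structure_coarse_of_base:
  assumes base: "\<And>A. A \<in> \<A> \<Longrightarrow> Id_on X \<subseteq> A \<and> A \<subseteq> X \<times> X"
    and comp: "\<And>A A'. A \<in> \<A> \<Longrightarrow> A' \<in> \<A> \<Longrightarrow> \<exists>C\<in>\<A>. A O A' \<subseteq> C"
    and conv: "\<And>A. A \<in> \<A> \<Longrightarrow> \<exists>C\<in>\<A>. A\<inverse> \<subseteq> C"
  shows "coarse_structure X (coarse_of_base X \<A>)"
  unfolding coarse_structure_def
proof (intro conjI ballI allI impI)
  fix E assume E: "E \<in> coarse_of_base X \<A>"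
  then obtain A where A: "Id_on X \<subseteq> E" "A \<in> \<A>" "E \<subseteq> A"
    by (auto simp: coarse_of_base_def)
  show "Id_on X \<subseteq> E" by (rule A(1))
  show "E \<subseteq> X \<times> X" using A base[OF A(2)] by blast
  obtain C where "C \<in> \<A>" "A\<inverse> \<subseteq> C" using conv[OF A(2)] by blast
  then show "E\<inverse> \<in> coarse_of_base X \<A>" using A unfolding coarse_of_base_def by blast
  {
    fix E' assume "E' \<in> coarse_of_base X \<A>"
    then obtain A' where A': "Id_on X \<subseteq> E'" "A' \<in> \<A>" "E' \<subseteq> A'"
      by (auto simp: coarse_of_base_def)
    obtain D where "D \<in> \<A>" "A O A' \<subseteq> D" using comp[OF A(2) A'(2)] by blast
    moreover have "E O E' \<subseteq> A O A'" using A(3) A'(3) by blast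
    moreover have "Id_on X \<subseteq> E O E'" using A(1) A'(1) by blast
    ultimately show "E O E' \<in> coarse_of_base X \<A>" unfolding coarse_of_base_def by blast
  }
  fix E' assume "Id_on X \<subseteq> E' \<and> E' \<subseteq> E"
  then show "E' \<in> coarse_of_base X \<A>" using A unfolding coarse_of_base_def by blast
qed

lemma discrete_entourage_in_coarse_of_base:
  assumes "B \<in> \<B>"
  shows "discrete_entourage X B \<in> coarse_of_base X (discrete_entourage X ` \<B>)"
proof -
  have "Id_on X \<subseteq> discrete_entourage X B" by (auto simp: discrete_entourage_def)
  then show ?thesis using assms unfolding coarse_of_base_def by blast
qed

lemma is_ballean_discrete_ballean:
  assumes "bornology X \<B>"
  shows "is_ballean (discrete_ballean X \<B>)"
proof -
  have sub: "\<B> \<subseteq> Pow X" and un: "\<And>A B. A \<in> \<B> \<Longrightarrow> B \<in> \<B> \<Longrightarrow> A \<union> B \<in> \<B>"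
    and fin: "\<And>F. F \<subseteq> X \<Longrightarrow> finite F \<Longrightarrow> F \<in> \<B>"
    using assms by (auto simp: bornology_def)
  have "coarse_structure X (coarse_of_base X (discrete_entourage X ` \<B>))"
  proof (rule coarse_structure_coarse_of_base)
    fix A assume "A \<in> discrete_entourage X ` \<B>"
    then obtain B where B: "B \<in> \<B>" "A = discrete_entourage X B" by blast
    have "B \<subseteq> X" using B sub by blast
    then show "Id_on X \<subseteq> A \<and> A \<subseteq> X \<times> X"
      using B by (auto simp: discrete_entourage_def split: if_splits)
    have "A\<inverse> \<subseteq> A" using B \<open>B \<subseteq> X\<close> by (auto simp: discrete_entourage_def split: if_splits)
    then show "\<exists>C\<in>discrete_entourage X ` \<B>. A\<inverse> \<subseteq> C" using B by blast
    fix A' assume "A' \<in> discrete_entourage X ` \<B>"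
    then obtain B' where B': "B' \<in> \<B>" "A' = discrete_entourage X B'" by blast
    have "A O A' \<subseteq> discrete_entourage X (B \<union> B')"
      using B B' by (auto simp: discrete_entourage_def split: if_splits)
    then show "\<exists>C\<in>discrete_entourage X ` \<B>. A O A' \<subseteq> C" using un[OF B(1) B'(1)] by blast
  qed
  moreover have "\<exists>E\<in>coarse_of_base X (discrete_entourage X ` \<B>). y \<in> E `` {x}"
    if "x \<in> X" "y \<in> X" for x y
  proof (intro bexI)
    show "y \<in> discrete_entourage X {x, y} `` {x}" using that by (simp add: discrete_entourage_def)
    have "{x, y} \<in> \<B>" using that by (intro fin) auto
    then show "discrete_entourage X {x, y} \<in> coarse_of_base X (discrete_entourage X ` \<B>)"
      by (rule discrete_entourage_in_coarse_of_base)
  qed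
  ultimately show ?thesis by (simp add: discrete_ballean_def)
qed

lemma is_ballean_hyperballean:
  assumes "is_ballean P"
  shows "is_ballean (hyperballean P)"
proof -
  obtain X \<E> where P: "P = (X, \<E>)" by (cases P)
  have cs: "coarse_structure X \<E>" and "\<forall>x\<in>X. \<forall>y\<in>X. \<exists>E\<in>\<E>. y \<in> E `` {x}"
    using assms by (simp_all add: P)
  then have conn: "\<exists>E\<in>\<E>. (x, y) \<in> E" if "x \<in> X" "y \<in> X" for x y
    using that by (simp add: Image_singleton)
  have diag: "Id_on X \<subseteq> E" if "E \<in> \<E>" for E
    using cs that by (simp add: coarse_structure_def)
  have comp: "E O E' \<in> \<E>" if "E \<in> \<E>" "E' \<in> \<E>" for E E'
    using cs that unfolding coarse_structure_def by blast
  have pts: "Y \<subseteq> X" if "Y \<in> hyper_points P" for Y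
    using that by (simp add: hyper_points_def P)
  have refl: "Id_on (hyper_points P) \<subseteq> hyper_entourage P E" if "E \<in> \<E>" for E
    using diag[OF that] pts unfolding hyper_entourage_def by blast
  let ?A = "hyper_entourage P ` \<E>"
  have "coarse_structure (hyper_points P) (coarse_of_base (hyper_points P) ?A)"
  proof (rule coarse_structure_coarse_of_base)
    fix A assume "A \<in> ?A"
    then obtain E where E: "E \<in> \<E>" "A = hyper_entourage P E" by blast
    show "Id_on (hyper_points P) \<subseteq> A \<and> A \<subseteq> hyper_points P \<times> hyper_points P"
      using refl[OF E(1)] E(2) by (auto simp: hyper_entourage_def)
    have "A\<inverse> \<subseteq> A" unfolding E(2) hyper_entourage_def by blast
    then show "\<exists>C\<in>?A. A\<inverse> \<subseteq> C" using E by blast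
    fix A' assume "A' \<in> ?A"
    then obtain F where F: "F \<in> \<E>" "A' = hyper_entourage P F" by blast
    have G: "(E O F) O (E O F) \<in> \<E>" by (intro comp E F)
    have "A O A' \<subseteq> hyper_entourage P ((E O F) O (E O F))"
    proof (rule subrelI)
      fix Y W assume "(Y, W) \<in> A O A'"
      then obtain Z where YZ: "(Y, Z) \<in> A" and ZW: "(Z, W) \<in> A'" by blast
      have in_pts: "Y \<in> hyper_points P" "Z \<in> hyper_points P" "W \<in> hyper_points P"
        and s: "Y \<subseteq> E `` Z" "Z \<subseteq> E `` Y" "Z \<subseteq> F `` W" "W \<subseteq> F `` Z"
        using YZ ZW unfolding E(2) F(2) hyper_entourage_def by blast+
      have subs: "Y \<subseteq> X" "Z \<subseteq> X" "W \<subseteq> X" using in_pts pts by blast+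
      note d = diag[OF E(1)] diag[OF F(1)]
      have "W \<subseteq> ((E O F) O (E O F)) `` Y"
      proof
        fix w assume "w \<in> W"
        then obtain z where "(z, w) \<in> F" "z \<in> Z" using s by blast
        moreover from this obtain y where "(y, z) \<in> E" "y \<in> Y" using s by blast
        moreover have "(w, w) \<in> E" "(w, w) \<in> F" using \<open>w \<in> W\<close> subs d by blast+
        ultimately show "w \<in> ((E O F) O (E O F)) `` Y" by blast
      qed
      moreover have "Y \<subseteq> ((E O F) O (E O F)) `` W"
      proof
        fix y assume "y \<in> Y"
        then obtain z where "(z, y) \<in> E" "z \<in> Z" using s by blast
        moreover from this obtain w where "(w, z) \<in> F" "w \<in> W" using s by blast
        moreover have "(w, w) \<in> E" "(y, y) \<in> F" using \<open>w \<in> W\<close> \<open>y \<in> Y\<close> subs d by blast+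
        ultimately show "y \<in> ((E O F) O (E O F)) `` W" by blast
      qed
      ultimately show "(Y, W) \<in> hyper_entourage P ((E O F) O (E O F))"
        using in_pts by (simp add: hyper_entourage_def)
    qed
    then show "\<exists>C\<in>?A. A O A' \<subseteq> C" using G by blast
  qed
  moreover have "\<exists>H\<in>coarse_of_base (hyper_points P) ?A. Z \<in> H `` {Y}"
    if Y: "Y \<in> hyper_points P" and Z: "Z \<in> hyper_points P" for Y Z
  proof -
    obtain E x where E: "E \<in> \<E>" "x \<in> X" "Y \<subseteq> E `` {x}"
      using Y unfolding hyper_points_def P bounded_in.simps by blast
    obtain F x' where F: "F \<in> \<E>" "x' \<in> X" "Z \<subseteq> F `` {x'}"
      using Z unfolding hyper_points_def P bounded_in.simps by blast
    obtain y z where y: "y \<in> Y" and z: "z \<in> Z"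
      using Y Z unfolding hyper_points_def by blast
    have yz: "y \<in> X" "z \<in> X" using y z pts[OF Y] pts[OF Z] by blast+
    obtain C where C: "C \<in> \<E>" "(y, x') \<in> C" using conn[OF yz(1) F(2)] by blast
    obtain D where D: "D \<in> \<E>" "(z, x) \<in> D" using conn[OF yz(2) E(2)] by blast
    define G where "G = (C O F) O (D O E)"
    have GE: "G \<in> \<E>" unfolding G_def by (intro comp C D E F)
    have d: "Id_on X \<subseteq> C O F" "Id_on X \<subseteq> D O E"
      by (intro diag comp C D E F)+
    have "Z \<subseteq> G `` Y"
    proof
      fix w assume "w \<in> Z"
      moreover from this have "(w, w) \<in> D O E" using d pts[OF Z] by blast
      moreover from \<open>w \<in> Z\<close> have "(y, w) \<in> C O F" using C F by blast
      ultimately show "w \<in> G `` Y" using y unfolding G_def by blast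
    qed
    moreover have "Y \<subseteq> G `` Z"
    proof
      fix w assume "w \<in> Y"
      moreover have "(z, z) \<in> C O F" using d yz by blast
      moreover from \<open>w \<in> Y\<close> have "(z, w) \<in> D O E" using D E by blast
      ultimately show "w \<in> G `` Z" using z unfolding G_def by blast
    qed
    ultimately have "Z \<in> hyper_entourage P G `` {Y}"
      using Y Z by (simp add: hyper_entourage_def)
    moreover have "hyper_entourage P G \<in> coarse_of_base (hyper_points P) ?A"
      using refl[OF GE] GE by (auto simp: coarse_of_base_def)
    ultimately show ?thesis by blast
  qed
  ultimately show ?thesis by (simp add: hyperballean_def P)
qed

lemma fst_bornology_hyperballean:
  assumes "bornology X \<B>"
  shows "fst (bornology_hyperballean X \<B>) = \<B> - {{}}"
proof -
  have sub: "\<B> \<subseteq> Pow X" and down: "\<And>A B. B \<in> \<B> \<Longrightarrow> A \<subseteq> B \<Longrightarrow> A \<in> \<B>"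
    and fin: "\<And>F. F \<subseteq> X \<Longrightarrow> finite F \<Longrightarrow> F \<in> \<B>"
    using assms by (auto simp: bornology_def)
  have "Y \<in> \<B>" if bdd: "bounded_in (discrete_ballean X \<B>) Y" for Y
  proof -
    obtain E x where E: "E \<in> coarse_of_base X (discrete_entourage X ` \<B>)" "x \<in> X" "Y \<subseteq> E `` {x}"
      using bdd unfolding discrete_ballean_def bounded_in.simps by blast
    then obtain B where B: "B \<in> \<B>" "E \<subseteq> discrete_entourage X B"
      unfolding coarse_of_base_def by blast
    have Y: "Y \<subseteq> discrete_entourage X B `` {x}" using E(3) B(2) by blast
    show ?thesis
    proof (cases "x \<in> B")
      case True
      then have "Y \<subseteq> B" using Y by (auto simp: discrete_entourage_def)
      then show ?thesis using down B by blast
    next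
      case False
      then have "Y \<subseteq> {x}" using Y by (auto simp: discrete_entourage_def)
      then show ?thesis using down[of "{x}"] fin[of "{x}"] E(2) by simp
    qed
  qed
  moreover have "bounded_in (discrete_ballean X \<B>) B" if B: "B \<in> \<B>" "B \<noteq> {}" for B
  proof -
    obtain x where x: "x \<in> B" using B(2) by blast
    have "discrete_entourage X B \<in> coarse_of_base X (discrete_entourage X ` \<B>)"
      using B(1) by (rule discrete_entourage_in_coarse_of_base)
    moreover have "B \<subseteq> discrete_entourage X B `` {x}" "x \<in> X" "B \<subseteq> X"
      using x B(1) sub by (auto simp: discrete_entourage_def)
    ultimately show ?thesis unfolding discrete_ballean_def bounded_in.simps by blast
  qed
  ultimately show ?thesis
    by (auto simp: bornology_hyperballean_def hyperballean_def hyper_points_def)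
qed

end

theory Submission
  imports Defs
begin

text \<open>
  Call the members of \<open>\<B>\<close> small. The ultrafilter hypothesis says that \<open>\<B>\<close> is a prime ideal:
  the whole set \<open>X\<close> is not small, and of two complementary sets one is small; in particular two
  disjoint sets are never both large. In the hyperballean two points \<open>Y\<close>, \<open>W\<close> are close
  on the scale of a small set \<open>B\<close> exactly when they are equal or both meet \<open>B\<close> and differ only
  inside \<open>B\<close>, and a family of points is bounded exactly when its union is small.

  Let \<open>P\<close> be a large set of least cardinality, well-ordered in the order type of that cardinal.
  Its initial segments \<open>I y\<close> are then small. Fix a base point \<open>b\<close>. The two families that
  violate normality are the points \<open>{b, x}\<close> and the points \<open>insert b (I y)\<close> for \<open>x, y \<in> P\<close>.
  They are asymptotically disjoint, because \<open>I y\<close> can only agree with a singleton outside a small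
  set \<open>B\<close> if \<open>y\<close> comes before the second element of \<open>P - B\<close>.

  Suppose that disjoint asymptotic neighbourhoods \<open>U\<close> and \<open>V\<close> separate them, and consider the
  points \<open>W = {b, x} \<union> I y\<close>. Such a point is close to \<open>{b, x}\<close> on a scale that depends only on
  \<open>y\<close>, and close to \<open>insert b (I y)\<close> on the scale of any small \<open>C\<close> that contains \<open>b\<close> and
  \<open>x\<close>. So if \<open>W\<close> is not in \<open>U\<close> then it lies inside a small set \<open>L y\<close>, and if it is not in
  \<open>V\<close> then it lies inside a small set \<open>G C\<close>. One of the two happens, and \<open>y \<notin> G C\<close> excludes
  the second. Hence every small subset of \<open>P\<close> is contained in some \<open>L y\<close> with \<open>y \<in> P\<close>.

  But each \<open>P - L y\<close> is large, hence equinumerous with \<open>P\<close>, so a transfinite recursion of length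
  \<open>|P|\<close> produces two disjoint subsets of \<open>P\<close> that meet all of the sets \<open>P - L y\<close>. Neither is
  contained in any \<open>L y\<close>, so both are large: a contradiction.
\<close>

section \<open>Disjoint transversals\<close>

unbundle cardinal_syntax

text \<open>This is the recursion from Bernstein's construction. At each stage fewer than \<open>|P|\<close> points
  have been used, so every set of the family still has two fresh ones.\<close>

lemma disjoint_transversals:
  fixes P :: "'i set" and S :: "'i \<Rightarrow> 'a set"
  assumes inf: "infinite P" and S: "\<And>y. y \<in> P \<Longrightarrow> |P| \<le>o |S y|"
  shows "\<exists>A A'. A \<inter> A' = {} \<and> (\<forall>y\<in>P. A \<inter> S y \<noteq> {} \<and> A' \<inter> S y \<noteq> {})"
proof -
  define r where "r = |P|"
  have wo: "well_order_on P r" unfolding r_def by (rule card_of_well_order_on)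
  define used where
    "used c y = fst ` c ` underS r y \<union> snd ` c ` underS r y" for c :: "'i \<Rightarrow> 'a \<times> 'a" and y
  define fresh where
    "fresh c y p \<longleftrightarrow> (y \<in> P \<longrightarrow> fst p \<noteq> snd p \<and> {fst p, snd p} \<subseteq> S y - used c y)" for c y p
  have "\<exists>c. \<forall>y. fresh c y (c y)"
  proof (rule dependent_wf_choice[where R = "r - Id"])
    show "wf (r - Id)" using wo by (simp add: well_order_on_def)
    show "fresh f y p = fresh g y p" if "\<And>z. (z, y) \<in> r - Id \<Longrightarrow> f z = g z" for f g y p
    proof -
      have "f ` underS r y = g ` underS r y"
        using that by (intro image_cong refl) (simp add: underS_def)
      then show ?thesis by (simp add: fresh_def used_def)
    qed
    show "\<exists>p. fresh c y p" for y c
    proof (cases "y \<in> P")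
      case True
      have ex: "\<exists>a. a \<in> S y - Q" if "|Q| <o |P|" for Q
      proof (rule ccontr)
        assume "\<nexists>a. a \<in> S y - Q"
        then have "|S y| \<le>o |Q|" by (intro card_of_mono1) blast
        with that S[OF True] show False
          by (meson not_ordLess_ordLeq ordLeq_transitive)
      qed
      have "|underS r y| <o |P|"
        using card_of_underS[OF card_of_Card_order[of P]] True by (simp add: r_def Field_card_of)
      then have "|fst ` c ` underS r y| <o |P|" "|snd ` c ` underS r y| <o |P|"
        by (meson card_of_image ordLeq_ordLess_trans)+
      then have Q: "|used c y| <o |P|"
        unfolding used_def by (rule card_of_Un_ordLess_infinite[OF inf])
      obtain a where a: "a \<in> S y - used c y" using ex[OF Q] by blast
      have "|{a}| <o |P|"
        by (rule finite_ordLess_infinite) (use inf in \<open>simp_all add: Field_card_of card_of_well_order_on\<close>)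
      then have "|{a} \<union> used c y| <o |P|" using Q by (rule card_of_Un_ordLess_infinite[OF inf])
      then obtain b where "b \<in> S y - ({a} \<union> used c y)" using ex by blast
      with a have "fresh c y (a, b)" by (auto simp: fresh_def)
      then show ?thesis ..
    qed (simp add: fresh_def)
  qed
  then obtain c where c: "\<And>y. fresh c y (c y)" by blast
  have "fst (c y) \<noteq> snd (c z)" if "y \<in> P" "z \<in> P" for y z
  proof -
    have fr: "fst (c x) \<noteq> snd (c x)" "fst (c x) \<notin> used c x" "snd (c x) \<notin> used c x"
      if "x \<in> P" for x
      using c[of x] that by (auto simp: fresh_def)
    have past: "fst (c x) \<in> used c x'" "snd (c x) \<in> used c x'" if "x \<in> underS r x'" for x x'
      using that by (auto simp: used_def)
    have "y = z \<or> y \<in> underS r z \<or> z \<in> underS r y"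
      using wo that by (auto simp: underS_def order_on_defs total_on_def)
    then show ?thesis using fr that past by metis
  qed
  then have "fst ` c ` P \<inter> snd ` c ` P = {}" by blast
  moreover have "fst (c y) \<in> S y" "snd (c y) \<in> S y" if "y \<in> P" for y
    using c[of y] that by (auto simp: fresh_def)
  then have "\<forall>y\<in>P. fst ` c ` P \<inter> S y \<noteq> {} \<and> snd ` c ` P \<inter> S y \<noteq> {}" by blast
  ultimately show ?thesis by blast
qed

section \<open>Ultrafilters and prime bornologies\<close>

text \<open>If \<open>A\<close> meets every member of the filter, then the filter generated by \<open>\<F>\<close> and \<open>A\<close> is
  proper, so maximality puts \<open>A\<close> into \<open>\<F>\<close>.\<close>

lemma ultrafilter_on_dichotomy:
  assumes uf: "ultrafilter_on X \<F>" and A: "A \<subseteq> X"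
  shows "A \<in> \<F> \<or> X - A \<in> \<F>"
proof (cases "\<exists>F\<in>\<F>. F \<inter> A = {}")
  case True
  then obtain F where F: "F \<in> \<F>" "F \<inter> A = {}" by blast
  have fl: "filter_on X \<F>" using uf by (simp add: ultrafilter_on_def)
  then have "F \<subseteq> X" using F by (auto simp: filter_on_def)
  then have "F \<subseteq> X - A" using F by blast
  with fl F(1) have "X - A \<in> \<F>" unfolding filter_on_def by blast
  then show ?thesis ..
next
  case False
  have fl: "filter_on X \<F>" using uf by (simp add: ultrafilter_on_def)
  define \<G> where "\<G> = {Z. Z \<subseteq> X \<and> (\<exists>F\<in>\<F>. F \<inter> A \<subseteq> Z)}"
  have X: "X \<in> \<F>" and int: "\<And>F F'. F \<in> \<F> \<Longrightarrow> F' \<in> \<F> \<Longrightarrow> F \<inter> F' \<in> \<F>"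
    using fl by (auto simp: filter_on_def)
  have "filter_on X \<G>"
    unfolding filter_on_def
  proof (intro conjI ballI allI impI)
    show "\<G> \<subseteq> Pow X" by (auto simp: \<G>_def)
    show "X \<in> \<G>" using X by (auto simp: \<G>_def)
    show "{} \<notin> \<G>" using False by (auto simp: \<G>_def)
  next
    fix Z Z' assume "Z \<in> \<G>" "Z' \<in> \<G>"
    then obtain F F' where F: "F \<in> \<F>" "F' \<in> \<F>"
      and sub: "F \<inter> A \<subseteq> Z" "F' \<inter> A \<subseteq> Z'" "Z \<subseteq> X"
      unfolding \<G>_def by blast
    have "(F \<inter> F') \<inter> A \<subseteq> Z \<inter> Z'" "Z \<inter> Z' \<subseteq> X" using sub by blast+
    with int[OF F] show "Z \<inter> Z' \<in> \<G>" unfolding \<G>_def by blast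
  next
    fix Z Z' assume "Z \<in> \<G>" "Z \<subseteq> Z' \<and> Z' \<subseteq> X"
    then show "Z' \<in> \<G>" unfolding \<G>_def by blast
  qed
  moreover have "\<F> \<subseteq> \<G>" using fl by (auto simp: filter_on_def \<G>_def)
  ultimately have "\<G> = \<F>" using uf by (simp add: ultrafilter_on_def)
  moreover have "A \<in> \<G>" using A X by (auto simp: \<G>_def)
  ultimately show ?thesis by simp
qed

locale prime_bornology =
  fixes X :: "'a set" and \<B> :: "'a set set"
  assumes bornology: "bornology X \<B>"
    and proper: "X \<notin> \<B>"
    and prime: "A \<subseteq> X \<Longrightarrow> A \<in> \<B> \<or> X - A \<in> \<B>"
begin

lemma small_subset: "B \<in> \<B> \<Longrightarrow> B \<subseteq> X"
  using bornology by (auto simp: bornology_def)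

lemma small_mono: "B \<in> \<B> \<Longrightarrow> A \<subseteq> B \<Longrightarrow> A \<in> \<B>"
  using bornology unfolding bornology_def by blast

lemma small_Un: "A \<in> \<B> \<Longrightarrow> B \<in> \<B> \<Longrightarrow> A \<union> B \<in> \<B>"
  using bornology by (auto simp: bornology_def)

lemma small_finite: "finite F \<Longrightarrow> F \<subseteq> X \<Longrightarrow> F \<in> \<B>"
  using bornology by (auto simp: bornology_def)

lemma large_diff:
  assumes "P \<subseteq> X" "P \<notin> \<B>" "B \<in> \<B>"
  shows "P - B \<notin> \<B>"
proof
  assume "P - B \<in> \<B>"
  then have "(P - B) \<union> B \<in> \<B>" using assms(3) by (rule small_Un)
  then show False using small_mono[of "(P - B) \<union> B" P] assms(2) by blast
qed

lemma disjoint_small: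
  assumes "A \<subseteq> X" "A' \<subseteq> X" "A \<inter> A' = {}"
  shows "A \<in> \<B> \<or> A' \<in> \<B>"
  using prime[OF assms(1)] small_mono[of "X - A" A'] assms by blast

section \<open>The hyperballean of a bornology\<close>

abbreviation hyper :: "'a set ballean"
  where "hyper \<equiv> bornology_hyperballean X \<B>"

lemma hyper_points_eq: "hyper_points (discrete_ballean X \<B>) = \<B> - {{}}"
  using fst_bornology_hyperballean[OF bornology]
  by (simp add: bornology_hyperballean_def hyperballean_def)

lemma hyper_eq: "hyper = (\<B> - {{}}, snd hyper)"
  using fst_bornology_hyperballean[OF bornology] by (metis prod.collapse)

lemma hyper_entourage_small_scale:
  assumes "E \<in> snd hyper"
  obtains B where "B \<in> \<B>"
    "\<And>Y W. (Y, W) \<in> E \<Longrightarrow> Y \<in> \<B> \<and> W \<in> \<B> \<and> W \<noteq> {} \<and> Y \<subseteq> W \<union> B \<and> W \<subseteq> Y \<union> B"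
proof -
  obtain D where D: "D \<in> snd (discrete_ballean X \<B>)"
    and E: "E \<subseteq> hyper_entourage (discrete_ballean X \<B>) D"
    using assms by (auto simp: bornology_hyperballean_def hyperballean_def coarse_of_base_def)
  obtain B where B: "B \<in> \<B>" and DB: "D \<subseteq> discrete_entourage X B"
    using D by (auto simp: discrete_ballean_def coarse_of_base_def)
  have "D `` Y \<subseteq> Y \<union> B" for Y
    using DB by (auto simp: discrete_entourage_def split: if_splits)
  then have "Y \<in> \<B> \<and> W \<in> \<B> \<and> W \<noteq> {} \<and> Y \<subseteq> W \<union> B \<and> W \<subseteq> Y \<union> B" if "(Y, W) \<in> E" for Y W
    using subsetD[OF E that] by (simp add: hyper_entourage_def hyper_points_eq) (meson order_trans)
  with B show ?thesis by (rule that)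
qed

text \<open>The sets have to meet \<open>B\<close> because the entourage of \<open>B\<close> enlarges \<open>Y\<close> to \<open>Y \<union> B\<close> only if
  \<open>Y\<close> meets \<open>B\<close>, and fixes \<open>Y\<close> otherwise.\<close>

lemma hyper_entourage_of_small:
  assumes B: "B \<in> \<B>"
  obtains E where "E \<in> snd hyper"
    "\<And>Y W. Y \<in> \<B> \<Longrightarrow> W \<in> \<B> \<Longrightarrow> Y \<inter> B \<noteq> {} \<Longrightarrow> W \<inter> B \<noteq> {} \<Longrightarrow>
      Y \<subseteq> W \<union> B \<Longrightarrow> W \<subseteq> Y \<union> B \<Longrightarrow> (Y, W) \<in> E"
proof -
  let ?D = "discrete_entourage X B"
  let ?E = "hyper_entourage (discrete_ballean X \<B>) ?D"
  have D: "?D \<in> snd (discrete_ballean X \<B>)"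
    using discrete_entourage_in_coarse_of_base[OF B] by (simp add: discrete_ballean_def)
  have refl: "Y \<subseteq> ?D `` Y" if "Y \<subseteq> X" for Y
    using that by (auto simp: discrete_entourage_def)
  have img: "Y \<union> B \<subseteq> ?D `` Y" if "Y \<in> \<B>" "Y \<inter> B \<noteq> {}" for Y
    using refl[OF small_subset[OF that(1)]] that(2) small_subset[OF B]
    by (auto simp: discrete_entourage_def)
  have "Id_on (hyper_points (discrete_ballean X \<B>)) \<subseteq> ?E"
    using refl small_subset by (auto simp: hyper_entourage_def hyper_points_eq)
  then have "?E \<in> snd hyper"
    using D by (auto simp: bornology_hyperballean_def hyperballean_def coarse_of_base_def)
  moreover have "(Y, W) \<in> ?E"
    if "Y \<in> \<B>" "W \<in> \<B>" "Y \<inter> B \<noteq> {}" "W \<inter> B \<noteq> {}" "Y \<subseteq> W \<union> B" "W \<subseteq> Y \<union> B" for Y W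
    using img[of Y] img[of W] that unfolding hyper_entourage_def hyper_points_eq by blast
  ultimately show ?thesis using that by blast
qed

lemma bounded_in_hyper_iff: "bounded_in hyper \<W> \<longleftrightarrow> \<W> \<subseteq> \<B> - {{}} \<and> \<Union>\<W> \<in> \<B>"
proof
  assume "bounded_in hyper \<W>"
  then have "bounded_in (\<B> - {{}}, snd hyper) \<W>" using hyper_eq by simp
  then obtain E Y where W: "\<W> \<subseteq> \<B> - {{}}" and E: "E \<in> snd hyper" and Y: "Y \<in> \<B>"
    and sub: "\<W> \<subseteq> E `` {Y}"
    by auto
  obtain B where "B \<in> \<B>" "\<And>Y W. (Y, W) \<in> E \<Longrightarrow> W \<subseteq> Y \<union> B"
    using hyper_entourage_small_scale[OF E] by metis
  then have "Y \<union> B \<in> \<B>" "\<Union>\<W> \<subseteq> Y \<union> B" using small_Un[OF Y] sub by blast+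
  then show "\<W> \<subseteq> \<B> - {{}} \<and> \<Union>\<W> \<in> \<B>" using W small_mono by blast
next
  assume W: "\<W> \<subseteq> \<B> - {{}} \<and> \<Union>\<W> \<in> \<B>"
  have "X \<noteq> {}" using proper small_finite[of "{}"] by auto
  then obtain b where b: "b \<in> X" by blast
  \<comment> \<open>The centre of the ball must be nonempty even when \<open>\<W>\<close> is empty.\<close>
  define C where "C = insert b (\<Union>\<W>)"
  have C: "C \<in> \<B>" using small_Un[of "{b}" "\<Union>\<W>"] small_finite[of "{b}"] W b by (simp add: C_def)
  obtain E where E: "E \<in> snd hyper"
    and close: "\<And>Y W. Y \<in> \<B> \<Longrightarrow> W \<in> \<B> \<Longrightarrow> Y \<inter> C \<noteq> {} \<Longrightarrow> W \<inter> C \<noteq> {} \<Longrightarrow>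
      Y \<subseteq> W \<union> C \<Longrightarrow> W \<subseteq> Y \<union> C \<Longrightarrow> (Y, W) \<in> E"
    using hyper_entourage_of_small[OF C] by metis
  have "\<W> \<subseteq> E `` {C}"
  proof
    fix Y assume Y: "Y \<in> \<W>"
    then have "Y \<subseteq> C" "Y \<in> \<B>" "Y \<noteq> {}" using W by (auto simp: C_def)
    then have "(C, Y) \<in> E" by (intro close C) (auto simp: C_def)
    then show "Y \<in> E `` {C}" by blast
  qed
  then have "bounded_in (\<B> - {{}}, snd hyper) \<W>"
    using W E C by (auto simp: C_def)
  then show "bounded_in hyper \<W>" using hyper_eq by simp
qed

lemma asymptotic_nbhd_hyper_iff:
  "asymptotic_nbhd hyper \<Y> U \<longleftrightarrow>
     U \<subseteq> \<B> - {{}} \<and> (\<forall>E\<in>snd hyper. bounded_in hyper (E `` \<Y> - U))"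
  by (metis hyper_eq asymptotic_nbhd.simps)

lemma asymptotically_disjoint_hyper_iff:
  "asymptotically_disjoint hyper \<Y> \<Z> \<longleftrightarrow>
     (\<forall>E\<in>snd hyper. bounded_in hyper (E `` \<Y> \<inter> E `` \<Z>))"
  by (metis hyper_eq asymptotically_disjoint.simps)

text \<open>The form in which asymptotic neighbourhoods enter the argument: on the scale of a small set
  \<open>B\<close>, one small set \<open>G\<close> catches every point that is near \<open>\<Y>\<close> but not in \<open>U\<close>. It is the union of
  the bounded family \<open>E `` \<Y> - U\<close>, where \<open>E\<close> is the entourage of \<open>B\<close>.\<close>

lemma asymptotic_nbhd_exceptional_set:
  assumes nbhd: "asymptotic_nbhd hyper \<Y> U" and B: "B \<in> \<B>"
  shows "\<exists>G\<in>\<B>. \<forall>Y\<in>\<Y>. \<forall>W\<in>\<B>. Y \<in> \<B> \<and> Y \<inter> B \<noteq> {} \<and> W \<inter> B \<noteq> {} \<and>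
           Y \<subseteq> W \<union> B \<and> W \<subseteq> Y \<union> B \<and> W \<notin> U \<longrightarrow> W \<subseteq> G"
proof -
  obtain E where E: "E \<in> snd hyper"
    and close: "\<And>Y W. Y \<in> \<B> \<Longrightarrow> W \<in> \<B> \<Longrightarrow> Y \<inter> B \<noteq> {} \<Longrightarrow> W \<inter> B \<noteq> {} \<Longrightarrow>
      Y \<subseteq> W \<union> B \<Longrightarrow> W \<subseteq> Y \<union> B \<Longrightarrow> (Y, W) \<in> E"
    using hyper_entourage_of_small[OF B] by metis
  have "\<Union>(E `` \<Y> - U) \<in> \<B>"
    using nbhd E by (auto simp: asymptotic_nbhd_hyper_iff bounded_in_hyper_iff)
  show ?thesis
  proof (intro bexI[where x = "\<Union>(E `` \<Y> - U)"] ballI impI)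
    fix Y W
    assume "Y \<in> \<Y>" "W \<in> \<B>" and "Y \<in> \<B> \<and> Y \<inter> B \<noteq> {} \<and> W \<inter> B \<noteq> {} \<and>
      Y \<subseteq> W \<union> B \<and> W \<subseteq> Y \<union> B \<and> W \<notin> U"
    then have "(Y, W) \<in> E" "W \<notin> U" using close[of Y W] by simp_all
    with \<open>Y \<in> \<Y>\<close> show "W \<subseteq> \<Union>(E `` \<Y> - U)" by blast
  qed fact
qed

section \<open>Failure of normality\<close>

lemma minimal_large_set:
  obtains P where "P \<subseteq> X" "P \<notin> \<B>" "\<And>Q. Q \<subseteq> X \<Longrightarrow> Q \<notin> \<B> \<Longrightarrow> |P| \<le>o |Q|"
proof -
  let ?R = "card_of ` {Q. Q \<subseteq> X \<and> Q \<notin> \<B>}"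
  have "?R \<noteq> {}" using proper by blast
  moreover have "\<forall>r\<in>?R. Card_order r" by (auto intro: card_of_Card_order)
  ultimately have "\<exists>r\<in>?R. \<forall>r'\<in>?R. r \<le>o r'" by (rule exists_minim_Card_order)
  then show ?thesis using that by blast
qed

text \<open>The sets \<open>P - L y\<close> are large, so by minimality they have at least \<open>|P|\<close> elements and
  there are two disjoint sets that meet all of them. By primeness one of the two is small inside
  \<open>P\<close>, and that one serves as \<open>C\<close>.\<close>

lemma small_set_escapes:
  assumes P: "P \<subseteq> X" "P \<notin> \<B>" and min: "\<And>Q. Q \<subseteq> X \<Longrightarrow> Q \<notin> \<B> \<Longrightarrow> |P| \<le>o |Q|"
    and L: "\<And>y. y \<in> P \<Longrightarrow> L y \<in> \<B>"
  shows "\<exists>C\<in>\<B>. C \<subseteq> P \<and> (\<forall>y\<in>P. \<not> C \<subseteq> L y)"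
proof -
  have inf: "infinite P" using P small_finite by blast
  have "|P| \<le>o |P - L y|" if "y \<in> P" for y
    using P large_diff[OF P L[OF that]] by (intro min) auto
  then obtain A A' where dj: "A \<inter> A' = {}"
    and tr: "\<forall>y\<in>P. A \<inter> (P - L y) \<noteq> {} \<and> A' \<inter> (P - L y) \<noteq> {}"
    using disjoint_transversals[OF inf, of "\<lambda>y. P - L y"] by blast
  have "A \<inter> P \<in> \<B> \<or> A' \<inter> P \<in> \<B>" using P dj by (intro disjoint_small) auto
  moreover have "\<forall>y\<in>P. \<not> A \<inter> P \<subseteq> L y \<and> \<not> A' \<inter> P \<subseteq> L y" using tr by blast
  ultimately show ?thesis by blast
qed

theorem hyper_not_normal: "\<not> normal_ballean hyper"
proof
  assume normal: "normal_ballean hyper"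
  obtain P where P: "P \<subseteq> X" "P \<notin> \<B>" and min: "\<And>Q. Q \<subseteq> X \<Longrightarrow> Q \<notin> \<B> \<Longrightarrow> |P| \<le>o |Q|"
    using minimal_large_set by blast
  have inf: "infinite P" using P small_finite by blast
  then obtain b where "b \<in> P" by fastforce
  then have b: "b \<in> X" using P by blast
  have ins: "insert x B \<in> \<B>" if "x \<in> X" "B \<in> \<B>" for x B
    using small_Un[OF small_finite[of "{x}"] that(2)] that(1) by simp

  define I where "I y = under |P| y" for y
  have wo: "well_order_on P |P|" by (rule card_of_well_order_on)
  have self: "y \<in> I y" if "y \<in> P" for y
    using wo that by (simp add: I_def under_def order_on_defs refl_on_def)
  have I_mono: "y \<in> I z \<Longrightarrow> I y \<subseteq> I z" for y z
    using wo unfolding I_def under_def order_on_defs trans_def by blast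
  have I_total: "y \<in> I z \<or> z \<in> I y" if "y \<in> P" "z \<in> P" for y z
    using wo that self[of y] by (auto simp: I_def under_def order_on_defs total_on_def)
  have I_sub: "I y \<subseteq> P" for y
    using Field_card_of[of P] by (auto simp: I_def under_def Field_def)
  have I_small: "I y \<in> \<B>" if "y \<in> P" for y
  proof -
    have "|underS |P| y| <o |P|"
      using card_of_underS[OF card_of_Card_order[of P]] that by (simp add: Field_card_of)
    moreover have "underS |P| y \<subseteq> X"
      using I_sub[of y] P(1) by (auto simp: I_def under_def underS_def)
    ultimately have "underS |P| y \<in> \<B>" using min not_ordLess_ordLeq by blast
    then have "insert y (underS |P| y) \<in> \<B>" using ins that P(1) by blast
    then show ?thesis by (rule small_mono) (auto simp: I_def under_def underS_def)
  qed

  define \<Y> where "\<Y> = (\<lambda>x. {b, x}) ` P"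
  define \<Z> where "\<Z> = (\<lambda>y. insert b (I y)) ` P"
  have Y_small: "{b, x} \<in> \<B>" if "x \<in> P" for x using that b P by (intro small_finite) auto
  have Z_small: "insert b (I y) \<in> \<B>" if "y \<in> P" for y using ins[OF b I_small[OF that]] .

  have "asymptotically_disjoint hyper \<Y> \<Z>"
    unfolding asymptotically_disjoint_hyper_iff
  proof
    fix E assume "E \<in> snd hyper"
    then obtain B where B: "B \<in> \<B>" and E: "\<And>Y W. (Y, W) \<in> E \<Longrightarrow>
        Y \<in> \<B> \<and> W \<in> \<B> \<and> W \<noteq> {} \<and> Y \<subseteq> W \<union> B \<and> W \<subseteq> Y \<union> B"
      using hyper_entourage_small_scale by metis
    define B' where "B' = insert b B"
    have B': "B' \<in> \<B>" using ins[OF b B] by (simp add: B'_def)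
    have "infinite (P - B')" using large_diff[OF P B'] P small_finite[of "P - B'"] by blast
    then obtain p where p: "p \<in> P - B'" using infinite_imp_nonempty by blast
    from \<open>infinite (P - B')\<close> have "infinite (P - B' - {p})" by simp
    then obtain q where "q \<in> P - B' - {p}" using infinite_imp_nonempty by blast
    then have q: "q \<in> P - B'" "q \<noteq> p" by blast+
    \<comment> \<open>An initial segment that agrees with a singleton outside \<open>B'\<close> omits \<open>p\<close> or \<open>q\<close>.\<close>
    have "W \<subseteq> (I p \<union> I q) \<union> B'" if W: "W \<in> E `` \<Y> \<inter> E `` \<Z>" for W
    proof -
      obtain x where x: "({b, x}, W) \<in> E" using W by (auto simp: \<Y>_def)
      obtain y where y: "y \<in> P" "(insert b (I y), W) \<in> E" using W by (auto simp: \<Z>_def)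
      have "I y \<subseteq> insert x B'" using E[OF x] E[OF y(2)] by (auto simp: B'_def)
      then have "p \<notin> I y \<or> q \<notin> I y" using p q by blast
      then have "y \<in> I p \<or> y \<in> I q" using I_total y(1) p q by blast
      then have "I y \<subseteq> I p \<union> I q" using I_mono by blast
      then show ?thesis using E[OF y(2)] by (auto simp: B'_def)
    qed
    then have "\<Union>(E `` \<Y> \<inter> E `` \<Z>) \<subseteq> (I p \<union> I q) \<union> B'" by blast
    moreover have "(I p \<union> I q) \<union> B' \<in> \<B>" using I_small p q B' by (intro small_Un) auto
    ultimately have "\<Union>(E `` \<Y> \<inter> E `` \<Z>) \<in> \<B>" using small_mono by blast
    moreover have "E `` \<Y> \<inter> E `` \<Z> \<subseteq> \<B> - {{}}" using E by blast
    ultimately show "bounded_in hyper (E `` \<Y> \<inter> E `` \<Z>)" by (simp add: bounded_in_hyper_iff)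
  qed
  moreover have "\<Y> \<subseteq> fst hyper" "\<Z> \<subseteq> fst hyper"
    using Y_small Z_small by (auto simp: \<Y>_def \<Z>_def fst_bornology_hyperballean[OF bornology])
  ultimately obtain U V where U: "asymptotic_nbhd hyper \<Y> U" and V: "asymptotic_nbhd hyper \<Z> V"
    and UV: "U \<inter> V = {}"
    using normal unfolding normal_ballean_def asymptotically_separated_def by blast

  \<comment> \<open>On the scale of \<open>insert b (I y)\<close> the mixed point is near \<open>{b, x}\<close>, whatever \<open>x\<close> is.\<close>
  have "\<forall>y\<in>P. \<exists>G\<in>\<B>. \<forall>x\<in>P. {b, x} \<union> I y \<notin> U \<longrightarrow> {b, x} \<union> I y \<subseteq> G"
  proof
    fix y assume y: "y \<in> P"
    obtain G where G: "G \<in> \<B>"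
      and near: "\<forall>Y\<in>\<Y>. \<forall>W\<in>\<B>. Y \<in> \<B> \<and> Y \<inter> insert b (I y) \<noteq> {} \<and> W \<inter> insert b (I y) \<noteq> {} \<and>
        Y \<subseteq> W \<union> insert b (I y) \<and> W \<subseteq> Y \<union> insert b (I y) \<and> W \<notin> U \<longrightarrow> W \<subseteq> G"
      using asymptotic_nbhd_exceptional_set[OF U Z_small[OF y]] by blast
    have "{b, x} \<union> I y \<subseteq> G" if "x \<in> P" "{b, x} \<union> I y \<notin> U" for x
      using near[rule_format, of "{b, x}" "{b, x} \<union> I y"] that Y_small[OF that(1)]
        small_Un[OF Y_small[OF that(1)] I_small[OF y]]
      by (auto simp: \<Y>_def)
    with G show "\<exists>G\<in>\<B>. \<forall>x\<in>P. {b, x} \<union> I y \<notin> U \<longrightarrow> {b, x} \<union> I y \<subseteq> G" by blast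
  qed
  from bchoice[OF this[unfolded Bex_def]] obtain L where L: "\<And>y. y \<in> P \<Longrightarrow> L y \<in> \<B>"
    and UL: "\<And>x y. x \<in> P \<Longrightarrow> y \<in> P \<Longrightarrow> {b, x} \<union> I y \<notin> U \<Longrightarrow> {b, x} \<union> I y \<subseteq> L y"
    by blast
  obtain C where C: "C \<in> \<B>" "C \<subseteq> P" and escape: "\<forall>y\<in>P. \<not> C \<subseteq> L y"
    using small_set_escapes[where L = L, OF P] min L by blast
  \<comment> \<open>On the scale of \<open>insert b C\<close> the mixed point is near \<open>insert b (I y)\<close>, whatever \<open>y\<close> is.\<close>
  have bC: "insert b C \<in> \<B>" using ins[OF b C(1)] .
  obtain G where G: "G \<in> \<B>"
    and near: "\<forall>Y\<in>\<Z>. \<forall>W\<in>\<B>. Y \<in> \<B> \<and> Y \<inter> insert b C \<noteq> {} \<and> W \<inter> insert b C \<noteq> {} \<and>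
      Y \<subseteq> W \<union> insert b C \<and> W \<subseteq> Y \<union> insert b C \<and> W \<notin> V \<longrightarrow> W \<subseteq> G"
    using asymptotic_nbhd_exceptional_set[OF V bC] by blast
  have VG: "{b, x} \<union> I y \<subseteq> G" if "x \<in> C" "y \<in> P" "{b, x} \<union> I y \<notin> V" for x y
  proof -
    have "x \<in> P" using that(1) C(2) by blast
    then show ?thesis
      using near[rule_format, of "insert b (I y)" "{b, x} \<union> I y"] that Z_small[OF that(2)]
        small_Un[OF Y_small I_small[OF that(2)]]
      by (auto simp: \<Z>_def)
  qed
  obtain y where y: "y \<in> P" "y \<notin> G" using small_mono[OF G, of P] P(2) by blast
  have "C \<subseteq> L y"
  proof
    fix x assume x: "x \<in> C"
    have "{b, x} \<union> I y \<in> V" using VG[OF x y(1)] y(2) self[OF y(1)] by blast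
    then have "{b, x} \<union> I y \<notin> U" using UV by blast
    then show "x \<in> L y" using UL[of x y] x C(2) y(1) by blast
  qed
  with escape y(1) show False by blast
qed

end

theorem corollary4p2:
  fixes \<kappa> :: "'a rel" and \<B> :: "'a set set"
  assumes "Card_order \<kappa>"
    and "bornology (Field \<kappa>) \<B>"
    and "ultrafilter_on (Field \<kappa>) {Field \<kappa> - B | B. B \<in> \<B>}"
  shows "\<not> normal_ballean (bornology_hyperballean (Field \<kappa>) \<B>)"
proof -
  let ?X = "Field \<kappa>" and ?\<F> = "{Field \<kappa> - B | B. B \<in> \<B>}"
  have sub: "\<B> \<subseteq> Pow ?X" using assms(2) by (simp add: bornology_def)
  have dual: "?X - A \<in> ?\<F> \<longleftrightarrow> A \<in> \<B>" if "A \<subseteq> ?X" for A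
  proof
    assume "?X - A \<in> ?\<F>"
    then obtain B where "?X - A = ?X - B" "B \<in> \<B>" by blast
    moreover from this have "A = B" using that sub by blast
    ultimately show "A \<in> \<B>" by simp
  qed blast
  have "{} \<notin> ?\<F>" using assms(3) by (simp add: ultrafilter_on_def filter_on_def)
  then have "?X \<notin> \<B>" using dual[of ?X] by simp
  moreover have "A \<in> \<B> \<or> ?X - A \<in> \<B>" if A: "A \<subseteq> ?X" for A
  proof -
    have "A = ?X - (?X - A)" using A by blast
    then have "A \<in> ?\<F> \<longleftrightarrow> ?X - A \<in> \<B>" using dual[of "?X - A"] by auto
    then show ?thesis using ultrafilter_on_dichotomy[OF assms(3) A] dual[OF A] by blast
  qed
  ultimately have "prime_bornology ?X \<B>" using assms(2) by unfold_locales
  then show ?thesis by (rule prime_bornology.hyper_not_normal)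
qed

end
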